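(* Let $X,Y$ be metric spaces, $X\times Y$ with the maximum metric, and let $g,h$ be Hausdorff functions. For any set $E\subseteq X\times Y$: (i) $\overline{\mathcal P}^{gh}(E)\ge\int^*\vec{\mathcal B}^{g}(E_x)\,d\overline{\mathcal P}^{h}(x)$; (ii) $\underline{\mathcal P}^{gh}(E)\ge\int^*\underline{\mathcal B}^{g}(E_x)\,d\underline{\mathcal P}^{h}(x)$; (iii) $\vec{\mathcal P}^{gh}(E)\ge\int^*\vec{\mathcal B}^{g}(E_x)\,d\underline{\mathcal P}^{h}(x)$; (iv) $\vec{\mathcal P}^{gh}(E)\ge\inf_{x\in X}\vec{\mathcal B}^{g}(E_x)\cdot\vec{\mathcal P}^{h}(X)$.
   Context: In a metric space $(X,d)$: $\operatorname{gap}F=\inf\{d(x,y):x,y\in F,x\neq y\}$, $C_\delta(E)=\sup\{|F|:F\subseteq E,\operatorname{gap}F>\delta\}$. A Hausdorff function is a nondecreasing $g:(0,\infty)\to(0,\infty)$; $gh$ is the pointwise product. A scale is a set $\Delta\subseteq(0,\infty)$ with $0$ in its closure. A packing is a family $\pi=\{(x_i,r_i):i\in I\}\subseteq X\times(0,\infty)$ with $d(x_i,x_j)>r_i$ for $i\ne j$; it is a packing of $E$ if all $x_i\in E$, $\Delta$-valued if all $r_i\in\Delta$, $\delta$-fine if all $r_i\le\delta$; $g(\pi)=\sum_ig(r_i)$. Let $\mathcal P^g_{\Delta,0}(E)=\inf_{\delta>0}\sup\{g(\pi):\pi$ a $\Delta$-valued $\delta$-fine packing of $E\}$. Set $\overline{\mathcal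 P}^g_0=\mathcal P^g_{(0,\infty),0}$, $\underline{\mathcal P}^g_0(E)=\inf_\Delta\mathcal P^g_{\Delta,0}(E)$ (infimum over all scales), $\underline{\mathcal B}^g_0(E)=\liminf_{\delta\to0}C_\delta(E)g(\delta)$. For a set function $\tau$ let $\widehat\tau(E)=\inf\{\sum_n\tau(E_n):E\subseteq\bigcup_nE_n\}$ (countable covers) and $\overrightarrow\tau(E)=\inf\{\sup_n\tau(E_n):E_n\uparrow E\}$, where $E_n\uparrow E$ means $(E_n)$ increasing with union $E$. Then $\overline{\mathcal P}^g=\widehat{\overline{\mathcal P}^g_0}$ (the packing measure), $\underline{\mathcal P}^g=\widehat{\underline{\mathcal P}^g_0}$, $\underline{\mathcal B}^g=\widehat{\underline{\mathcal B}^g_0}$ (Hewitt–Stromberg measure), $\vec{\mathcal P}^g=\overrightarrow{\underline{\mathcal P}^g_0}$, $\vec{\mathcal B}^g=\overrightarrow{\underline{\mathcal B}^g_0}$. The set functions $\overline{\mathcal P}^h,\underline{\mathcal P}^h$ are Borel measures when restricted to Borel sets. $E_x=\{y:(x,y)\in E\}$. Upper integral: $\int^*f\,d\mu=\inf\{\int\varphi\,d\mu:\varphi\ge f$ Borel measurable$\}$. *)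

theory Defs
  imports "HOL-Analysis.Analysis"
begin

definition gap :: "('a \<Rightarrow> 'a \<Rightarrow> real) \<Rightarrow> 'a set \<Rightarrow> ennreal" where
  "gap d F = (INF p \<in> {(x, y). x \<in> F \<and> y \<in> F \<and> x \<noteq> y}. ennreal (d (fst p) (snd p)))"

definition ecard :: "'a set \<Rightarrow> ennreal" where
  "ecard F = (if finite F then of_nat (card F) else \<infinity>)"

definition capacity :: "('a \<Rightarrow> 'a \<Rightarrow> real) \<Rightarrow> real \<Rightarrow> 'a set \<Rightarrow> ennreal" where
  "capacity d \<delta> E = (SUP F \<in> {F. F \<subseteq> E \<and> gap d F > ennreal \<delta>}. ecard F)"

definition hausdorff_fun :: "(real \<Rightarrow> real) \<Rightarrow> bool" where
  "hausdorff_fun g \<longleftrightarrow> mono_on {0<..} g \<and> (\<forall>r>0. g r > 0)"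

text \<open>A packing, represented as the set of its pairs (distinct indices give distinct pairs).\<close>
definition is_packing :: "('a \<Rightarrow> 'a \<Rightarrow> real) \<Rightarrow> ('a \<times> real) set \<Rightarrow> bool" where
  "is_packing d P \<longleftrightarrow> (\<forall>p\<in>P. snd p > 0) \<and>
     (\<forall>p\<in>P. \<forall>q\<in>P. p \<noteq> q \<longrightarrow> d (fst p) (fst q) > snd p)"

definition gsum :: "(real \<Rightarrow> real) \<Rightarrow> ('a \<times> real) set \<Rightarrow> ennreal" where
  "gsum g P = (SUP F \<in> {F. finite F \<and> F \<subseteq> P}. (\<Sum>p\<in>F. ennreal (g (snd p))))"

definition P0 :: "('a \<Rightarrow> 'a \<Rightarrow> real) \<Rightarrow> (real \<Rightarrow> real) \<Rightarrow> real set \<Rightarrow> 'a set \<Rightarrow> ennreal" where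
  "P0 d g \<Delta> E = (INF \<delta> \<in> {0<..}. SUP P \<in> {P. is_packing d P \<and> fst ` P \<subseteq> E \<and>
       snd ` P \<subseteq> \<Delta> \<and> (\<forall>r \<in> snd ` P. r \<le> \<delta>)}. gsum g P)"

definition is_scale :: "real set \<Rightarrow> bool" where
  "is_scale \<Delta> \<longleftrightarrow> \<Delta> \<subseteq> {0<..} \<and> 0 \<in> closure \<Delta>"

definition Pbar0 :: "('a \<Rightarrow> 'a \<Rightarrow> real) \<Rightarrow> (real \<Rightarrow> real) \<Rightarrow> 'a set \<Rightarrow> ennreal" where
  "Pbar0 d g E = P0 d g {0<..} E"

definition Plow0 :: "('a \<Rightarrow> 'a \<Rightarrow> real) \<Rightarrow> (real \<Rightarrow> real) \<Rightarrow> 'a set \<Rightarrow> ennreal" where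
  "Plow0 d g E = (INF \<Delta> \<in> {\<Delta>. is_scale \<Delta>}. P0 d g \<Delta> E)"

definition B0 :: "('a \<Rightarrow> 'a \<Rightarrow> real) \<Rightarrow> (real \<Rightarrow> real) \<Rightarrow> 'a set \<Rightarrow> ennreal" where
  "B0 d g E = Liminf (at_right 0) (\<lambda>\<delta>. capacity d \<delta> E * ennreal (g \<delta>))"

definition hat :: "('a set \<Rightarrow> ennreal) \<Rightarrow> 'a set \<Rightarrow> ennreal" where
  "hat \<tau> E = (INF A \<in> {A :: nat \<Rightarrow> 'a set. E \<subseteq> (\<Union>n. A n)}. (\<Sum>n. \<tau> (A n)))"

definition arrow :: "('a set \<Rightarrow> ennreal) \<Rightarrow> 'a set \<Rightarrow> ennreal" where
  "arrow \<tau> E = (INF A \<in> {A :: nat \<Rightarrow> 'a set. incseq A \<and> (\<Union>n. A n) = E}. (SUP n. \<tau> (A n)))"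

definition Pbar :: "('a \<Rightarrow> 'a \<Rightarrow> real) \<Rightarrow> (real \<Rightarrow> real) \<Rightarrow> 'a set \<Rightarrow> ennreal" where
  "Pbar d g = hat (Pbar0 d g)"

definition Plow :: "('a \<Rightarrow> 'a \<Rightarrow> real) \<Rightarrow> (real \<Rightarrow> real) \<Rightarrow> 'a set \<Rightarrow> ennreal" where
  "Plow d g = hat (Plow0 d g)"

definition Blow :: "('a \<Rightarrow> 'a \<Rightarrow> real) \<Rightarrow> (real \<Rightarrow> real) \<Rightarrow> 'a set \<Rightarrow> ennreal" where
  "Blow d g = hat (B0 d g)"

definition Pvec :: "('a \<Rightarrow> 'a \<Rightarrow> real) \<Rightarrow> (real \<Rightarrow> real) \<Rightarrow> 'a set \<Rightarrow> ennreal" where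
  "Pvec d g = arrow (Plow0 d g)"

definition Bvec :: "('a \<Rightarrow> 'a \<Rightarrow> real) \<Rightarrow> (real \<Rightarrow> real) \<Rightarrow> 'a set \<Rightarrow> ennreal" where
  "Bvec d g = arrow (B0 d g)"

definition maxdist :: "('a::metric_space \<times> 'b::metric_space) \<Rightarrow> ('a \<times> 'b) \<Rightarrow> real" where
  "maxdist p q = max (dist (fst p) (fst q)) (dist (snd p) (snd q))"

definition xsection :: "('a \<times> 'b) set \<Rightarrow> 'a \<Rightarrow> 'b set" where
  "xsection E x = {y. (x, y) \<in> E}"

definition borel_restr :: "('a::topological_space set \<Rightarrow> ennreal) \<Rightarrow> 'a measure" where
  "borel_restr \<mu> = measure_of UNIV (sets borel) \<mu>"

definition upper_integral :: "'a measure \<Rightarrow> ('a \<Rightarrow> ennreal) \<Rightarrow> ennreal" where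
  "upper_integral M f = (INF \<phi> \<in> {\<phi>. \<phi> \<in> borel_measurable M \<and> (\<forall>x\<in>space M. f x \<le> \<phi> x)}.
      (\<integral>\<^sup>+ x. \<phi> x \<partial>M))"

end

theory Submission
  imports Defs
begin

text \<open>
  A packing of a set \<open>A\<close> in the first factor lifts to a packing of \<open>E\<close>: over the centre \<open>x\<close> of a ball
  of radius \<open>r\<close> put a large family of points of \<open>E\<^sub>x\<close> that are more than \<open>r\<close> apart. If
  \<open>C\<^sub>r(E\<^sub>x) g(r) > s\<close> for all \<open>x \<in> A\<close> and all small \<open>r\<close>, this multiplies the weight by at least \<open>s\<close>.

  Non-measurability of the level sets \<open>A\<^sub>j = {x. C\<^sub>r(E\<^sub>x) g(r) > s\<^sub>j for all small r}\<close> does no harm: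
  finite packings of the closure of \<open>A\<^sub>j\<close> can be moved into \<open>A\<^sub>j\<close>. The differences of successive
  closures are increasing unions of closed sets at positive distance from the higher levels, so packings of the
  different layers can be combined, and the step function over the closures is a Borel majorant with
  integral at most \<open>P\<^sub>0(E)\<close>. Fatou's lemma passes from step functions to \<open>B\<^sub>0(E\<^sub>x)\<close>, and then
  from \<open>E\<^sub>n\<close> to the union \<open>E\<close>. For the packing measure, finite subadditivity of the premeasure
  turns countable covers into increasing unions.
\<close>

section \<open>Finite packings and the packing premeasure\<close>

definition fine_packings :: "('a \<Rightarrow> 'a \<Rightarrow> real) \<Rightarrow> real set \<Rightarrow> real \<Rightarrow> 'a set \<Rightarrow> ('a \<times> real) set set" where
  "fine_packings d \<Delta> \<delta> E = {P. finite P \<and> is_packing d P \<and> fst ` P \<subseteq> E \<and> snd ` P \<subseteq> \<Delta> \<and>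
     (\<forall>r \<in> snd ` P. r \<le> \<delta>)}"

definition packing_sup ::
    "('a \<Rightarrow> 'a \<Rightarrow> real) \<Rightarrow> (real \<Rightarrow> real) \<Rightarrow> real set \<Rightarrow> real \<Rightarrow> 'a set \<Rightarrow> ennreal" where
  "packing_sup d g \<Delta> \<delta> E = (SUP P \<in> fine_packings d \<Delta> \<delta> E. \<Sum>p\<in>P. ennreal (g (snd p)))"

lemma hausdorff_fun_pos: "hausdorff_fun g \<Longrightarrow> 0 < r \<Longrightarrow> 0 < g r"
  by (simp add: hausdorff_fun_def)

lemma is_packing_subset: "is_packing d P \<Longrightarrow> Q \<subseteq> P \<Longrightarrow> is_packing d Q"
  unfolding is_packing_def by (meson subsetD)

lemma fine_packings_nonempty: "fine_packings d \<Delta> \<delta> E \<noteq> {}"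
proof -
  have "{} \<in> fine_packings d \<Delta> \<delta> E"
    by (simp add: fine_packings_def is_packing_def)
  then show ?thesis by blast
qed

lemma fine_packings_restrict:
  "P \<in> fine_packings d \<Delta> \<delta> E \<Longrightarrow> {p\<in>P. fst p \<in> A} \<in> fine_packings d \<Delta> \<delta> A"
  unfolding fine_packings_def by (auto intro: is_packing_subset[where P=P])

lemma sum_le_packing_sup:
  "P \<in> fine_packings d \<Delta> \<delta> E \<Longrightarrow> (\<Sum>p\<in>P. ennreal (g (snd p))) \<le> packing_sup d g \<Delta> \<delta> E"
  unfolding packing_sup_def by (rule SUP_upper)

lemma packing_sup_mono: "\<delta> \<le> \<delta>' \<Longrightarrow> packing_sup d g \<Delta> \<delta> E \<le> packing_sup d g \<Delta> \<delta>' E"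
  unfolding packing_sup_def by (rule SUP_subset_mono) (auto simp: fine_packings_def)

lemma packing_sup_mono_set: "A \<subseteq> B \<Longrightarrow> packing_sup d g \<Delta> \<delta> A \<le> packing_sup d g \<Delta> \<delta> B"
  unfolding packing_sup_def by (rule SUP_subset_mono) (auto simp: fine_packings_def)

text \<open>\<open>gsum\<close> is a supremum over finite subsets, and subsets of packings are
  packings, so infinite packings add nothing to the inner supremum.\<close>

lemma P0_eq_INF_packing_sup: "P0 d g \<Delta> E = (INF \<delta>\<in>{0<..}. packing_sup d g \<Delta> \<delta> E)"
proof -
  have "(SUP P \<in> {P. is_packing d P \<and> fst ` P \<subseteq> E \<and> snd ` P \<subseteq> \<Delta> \<and> (\<forall>r \<in> snd ` P. r \<le> \<delta>)}. gsum g P)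
      = packing_sup d g \<Delta> \<delta> E" (is "(SUP P\<in>?A. _) = _") for \<delta>
  proof (rule antisym)
    show "(SUP P\<in>?A. gsum g P) \<le> packing_sup d g \<Delta> \<delta> E"
    proof (rule SUP_least)
      fix P assume P: "P \<in> ?A"
      show "gsum g P \<le> packing_sup d g \<Delta> \<delta> E"
        unfolding gsum_def
      proof (rule SUP_least)
        fix F assume "F \<in> {F. finite F \<and> F \<subseteq> P}"
        with P have "F \<in> fine_packings d \<Delta> \<delta> E"
          unfolding fine_packings_def by (auto intro: is_packing_subset[where P=P])
        then show "(\<Sum>p\<in>F. ennreal (g (snd p))) \<le> packing_sup d g \<Delta> \<delta> E"
          by (rule sum_le_packing_sup)
      qed
    qed
    show "packing_sup d g \<Delta> \<delta> E \<le> (SUP P\<in>?A. gsum g P)"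
      unfolding packing_sup_def
    proof (rule SUP_least)
      fix P assume P: "P \<in> fine_packings d \<Delta> \<delta> E"
      then have "(\<Sum>p\<in>P. ennreal (g (snd p))) \<le> gsum g P"
        unfolding gsum_def by (intro SUP_upper) (auto simp: fine_packings_def)
      also have "\<dots> \<le> (SUP P\<in>?A. gsum g P)"
        using P by (intro SUP_upper) (auto simp: fine_packings_def)
      finally show "(\<Sum>p\<in>P. ennreal (g (snd p))) \<le> (SUP P\<in>?A. gsum g P)" .
    qed
  qed
  then show ?thesis by (simp add: P0_def)
qed

lemma P0_le_packing_sup: "0 < \<delta> \<Longrightarrow> P0 d g \<Delta> E \<le> packing_sup d g \<Delta> \<delta> E"
  unfolding P0_eq_INF_packing_sup by (rule INF_lower) simp

text \<open>Since \<open>packing_sup\<close> is monotone in the fineness, small \<delta> alone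
  decide the infimum.\<close>

lemma le_P0_I:
  assumes "0 < \<eta>" and "\<And>\<delta>. 0 < \<delta> \<Longrightarrow> \<delta> < \<eta> \<Longrightarrow> c \<le> packing_sup d g \<Delta> \<delta> E"
  shows "c \<le> P0 d g \<Delta> E"
  unfolding P0_eq_INF_packing_sup
proof (rule INF_greatest)
  fix \<delta> :: real assume "\<delta> \<in> {0<..}"
  with assms(1) have "c \<le> packing_sup d g \<Delta> (min \<delta> (\<eta>/2)) E"
    by (intro assms(2)) auto
  also have "\<dots> \<le> packing_sup d g \<Delta> \<delta> E"
    by (rule packing_sup_mono) simp
  finally show "c \<le> packing_sup d g \<Delta> \<delta> E" .
qed

lemma P0_mono_set: "A \<subseteq> B \<Longrightarrow> P0 d g \<Delta> A \<le> P0 d g \<Delta> B"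
  unfolding P0_eq_INF_packing_sup by (intro INF_mono) (auto intro: packing_sup_mono_set)

lemma P0_empty: "P0 d g \<Delta> {} = 0"
proof -
  have "fine_packings d \<Delta> 1 {} \<subseteq> {{}}"
    by (auto simp: fine_packings_def)
  then have "packing_sup d g \<Delta> 1 {} \<le> 0"
    unfolding packing_sup_def by (intro SUP_least) auto
  with P0_le_packing_sup[of 1 d g \<Delta> "{}"] show ?thesis by simp
qed

text \<open>A packing of the union splits according to where its centres lie. Pairs over the
  intersection are counted twice, which only enlarges the right-hand side.\<close>

lemma packing_sup_Un_le:
  "packing_sup d g \<Delta> \<delta> (A \<union> B) \<le> packing_sup d g \<Delta> \<delta> A + packing_sup d g \<Delta> \<delta> B"
  unfolding packing_sup_def[of d g \<Delta> \<delta> "A \<union> B"]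
proof (rule SUP_least)
  fix P assume P: "P \<in> fine_packings d \<Delta> \<delta> (A \<union> B)"
  then have "P \<subseteq> {p\<in>P. fst p \<in> A} \<union> {p\<in>P. fst p \<in> B}" and "finite P"
    by (auto simp: fine_packings_def)
  then have "(\<Sum>p\<in>P. ennreal (g (snd p))) \<le>
      (\<Sum>p\<in>{p\<in>P. fst p \<in> A} \<union> {p\<in>P. fst p \<in> B}. ennreal (g (snd p)))"
    by (intro sum_mono2) auto
  also have "\<dots> \<le> (\<Sum>p\<in>{p\<in>P. fst p \<in> A}. ennreal (g (snd p))) + (\<Sum>p\<in>{p\<in>P. fst p \<in> B}. ennreal (g (snd p)))"
    using \<open>finite P\<close> by (subst sum.union_inter[symmetric]) auto
  also have "\<dots> \<le> packing_sup d g \<Delta> \<delta> A + packing_sup d g \<Delta> \<delta> B"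
    using P by (intro add_mono sum_le_packing_sup fine_packings_restrict)
  finally show "(\<Sum>p\<in>P. ennreal (g (snd p))) \<le> packing_sup d g \<Delta> \<delta> A + packing_sup d g \<Delta> \<delta> B" .
qed

text \<open>Each infimum is nearly attained at its own fineness, and monotonicity allows passing to
  the smaller of the two.\<close>

lemma P0_Un_le: "P0 d g \<Delta> (A \<union> B) \<le> P0 d g \<Delta> A + P0 d g \<Delta> B"
proof (rule ennreal_le_epsilon)
  fix e :: real assume fin: "P0 d g \<Delta> A + P0 d g \<Delta> B < top" and e: "0 < e"
  have *: "\<exists>\<delta>>0. packing_sup d g \<Delta> \<delta> C \<le> P0 d g \<Delta> C + ennreal (e/2)" if "P0 d g \<Delta> C < top" for C
  proof -
    have "P0 d g \<Delta> C + 0 < P0 d g \<Delta> C + ennreal (e/2)"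
      unfolding ennreal_add_left_cancel_less using that e by (simp add: less_top)
    then have "(INF \<delta>\<in>{0<..}. packing_sup d g \<Delta> \<delta> C) < P0 d g \<Delta> C + ennreal (e/2)"
      by (simp flip: P0_eq_INF_packing_sup)
    then obtain \<delta> where "\<delta> \<in> {0<..}" "packing_sup d g \<Delta> \<delta> C < P0 d g \<Delta> C + ennreal (e/2)"
      unfolding INF_less_iff by blast
    then show ?thesis by (intro exI[of _ \<delta>]) (simp add: less_imp_le)
  qed
  from fin have "P0 d g \<Delta> A < top" "P0 d g \<Delta> B < top" by auto
  from this[THEN *] obtain a b
    where a: "a > 0" "packing_sup d g \<Delta> a A \<le> P0 d g \<Delta> A + ennreal (e/2)"
      and b: "b > 0" "packing_sup d g \<Delta> b B \<le> P0 d g \<Delta> B + ennreal (e/2)"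
    by blast
  have "P0 d g \<Delta> (A \<union> B) \<le> packing_sup d g \<Delta> (min a b) (A \<union> B)"
    using a b by (intro P0_le_packing_sup) simp
  also have "\<dots> \<le> packing_sup d g \<Delta> (min a b) A + packing_sup d g \<Delta> (min a b) B"
    by (rule packing_sup_Un_le)
  also have "\<dots> \<le> packing_sup d g \<Delta> a A + packing_sup d g \<Delta> b B"
    by (intro add_mono packing_sup_mono) auto
  also have "\<dots> \<le> (P0 d g \<Delta> A + ennreal (e/2)) + (P0 d g \<Delta> B + ennreal (e/2))"
    using a b by (intro add_mono) auto
  also have "\<dots> = P0 d g \<Delta> A + P0 d g \<Delta> B + (ennreal (e/2) + ennreal (e/2))"
    by (simp add: ac_simps)
  also have "ennreal (e/2) + ennreal (e/2) = ennreal e"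
    using e ennreal_plus[of "e/2" "e/2"] by simp
  finally show "P0 d g \<Delta> (A \<union> B) \<le> P0 d g \<Delta> A + P0 d g \<Delta> B + ennreal e" .
qed

lemma P0_UN_le: "P0 d g \<Delta> (\<Union>i<n. A i) \<le> (\<Sum>i<n. P0 d g \<Delta> (A i))" for n :: nat
proof (induction n)
  case (Suc n)
  have "P0 d g \<Delta> (\<Union>i<Suc n. A i) = P0 d g \<Delta> ((\<Union>i<n. A i) \<union> A n)"
    by (simp add: lessThan_Suc Un_commute)
  also have "\<dots> \<le> P0 d g \<Delta> (\<Union>i<n. A i) + P0 d g \<Delta> (A n)"
    by (rule P0_Un_le)
  also have "\<dots> \<le> (\<Sum>i<Suc n. P0 d g \<Delta> (A i))"
    using Suc by (auto intro: add_mono)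
  finally show ?case .
qed (simp add: P0_empty)

section \<open>Lifting packings to the product\<close>

lemma exists_separated_of_less_capacity:
  assumes "0 \<le> r" and "0 < a" and "c < capacity d r E * ennreal a"
  shows "\<exists>F. finite F \<and> F \<subseteq> E \<and> (\<forall>x\<in>F. \<forall>y\<in>F. x \<noteq> y \<longrightarrow> r < d x y) \<and>
    c \<le> of_nat (card F) * ennreal a"
proof -
  from assms(3) obtain F where F: "F \<subseteq> E" "gap d F > ennreal r" "c < ecard F * ennreal a"
    unfolding capacity_def SUP_mult_right_ennreal less_SUP_iff by auto
  have sep: "r < d x y" if "x \<in> F" "y \<in> F" "x \<noteq> y" for x y
  proof -
    have "gap d F \<le> ennreal (d x y)"
      unfolding gap_def by (rule INF_lower2[where i="(x, y)"]) (use that in auto)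
    with F(2) have "ennreal r < ennreal (d x y)" by (rule less_le_trans)
    then show ?thesis using assms(1) by (simp add: ennreal_less_iff)
  qed
  show ?thesis
  proof (cases "finite F")
    case True
    with F sep show ?thesis by (intro exI[of _ F]) (auto simp: ecard_def less_imp_le)
  next
    case False
    \<comment> \<open>Being strictly below another value, \<open>c\<close> is finite, so a large
      enough finite subset of the infinite set \<open>F\<close> already outweighs it.\<close>
    have "c < top" using F(3) by (auto simp: less_top[symmetric])
    then obtain b where b: "c = ennreal b" "0 \<le> b" by (cases c) auto
    obtain n :: nat where n: "b / a \<le> real n" using real_arch_simple by blast
    obtain G where G: "finite G" "G \<subseteq> F" "card G = n"
      using infinite_arbitrarily_large[OF False] by blast
    have "b \<le> real n * a" using n assms(2) by (simp add: divide_le_eq)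
    then have "c \<le> of_nat (card G) * ennreal a"
      using assms(2) b G by (simp add: ennreal_of_nat_eq_real_of_nat ennreal_leI flip: ennreal_mult)
    with G F(1) show ?thesis by (intro exI[of _ G]) (auto intro!: sep)
  qed
qed

text \<open>Every \<open>(x\<^sub>i, r\<^sub>i)\<close> is replaced by the pairs \<open>((x\<^sub>i, y), r\<^sub>i)\<close> with \<open>y\<close> in an \<open>r\<^sub>i\<close>-separated subset of \<open>E\<close> over \<open>x\<^sub>i\<close>.\<close>

lemma sum_le_product_packing_sup:
  fixes x :: "'i \<Rightarrow> 'a::metric_space" and E :: "('a \<times> 'b::metric_space) set"
  assumes "finite I"
    and r: "\<And>i. i \<in> I \<Longrightarrow> 0 < r i" "\<And>i. i \<in> I \<Longrightarrow> r i \<in> \<Delta>" "\<And>i. i \<in> I \<Longrightarrow> r i \<le> \<delta>"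
    and sep: "\<And>i j. i \<in> I \<Longrightarrow> j \<in> I \<Longrightarrow> i \<noteq> j \<Longrightarrow> r i < dist (x i) (x j)"
    and c: "\<And>i. i \<in> I \<Longrightarrow> c i < capacity dist (r i) (xsection E (x i)) * ennreal (g (r i))"
    and g: "hausdorff_fun g" and h: "hausdorff_fun h"
  shows "(\<Sum>i\<in>I. c i * ennreal (h (r i))) \<le> packing_sup maxdist (\<lambda>r. g r * h r) \<Delta> \<delta> E"
proof -
  have "\<forall>i\<in>I. \<exists>F. finite F \<and> F \<subseteq> xsection E (x i) \<and> (\<forall>y\<in>F. \<forall>z\<in>F. y \<noteq> z \<longrightarrow> r i < dist y z) \<and>
      c i \<le> of_nat (card F) * ennreal (g (r i))"
    using r(1) hausdorff_fun_pos[OF g] c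
    by (intro ballI exists_separated_of_less_capacity) (auto intro: less_imp_le)
  from bchoice[OF this] obtain F where
    "\<forall>i\<in>I. finite (F i) \<and> F i \<subseteq> xsection E (x i) \<and> (\<forall>y\<in>F i. \<forall>z\<in>F i. y \<noteq> z \<longrightarrow> r i < dist y z) \<and>
      c i \<le> of_nat (card (F i)) * ennreal (g (r i))" ..
  then have F: "\<And>i. i \<in> I \<Longrightarrow> finite (F i)" "\<And>i. i \<in> I \<Longrightarrow> F i \<subseteq> xsection E (x i)"
    "\<And>i y z. i \<in> I \<Longrightarrow> y \<in> F i \<Longrightarrow> z \<in> F i \<Longrightarrow> y \<noteq> z \<Longrightarrow> r i < dist y z"
    "\<And>i. i \<in> I \<Longrightarrow> c i \<le> of_nat (card (F i)) * ennreal (g (r i))"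
    by auto
  define m :: "'i \<times> 'b \<Rightarrow> ('a \<times> 'b) \<times> real" where "m = (\<lambda>(i, y). ((x i, y), r i))"
  \<comment> \<open>Different indices have centres at positive distance, so \<open>m\<close>
    identifies no pairs and the sum over its image loses nothing.\<close>
  have inj: "inj_on m (Sigma I F)"
  proof (rule inj_onI)
    fix p q assume "p \<in> Sigma I F" "q \<in> Sigma I F" "m p = m q"
    then show "p = q"
      using sep[of "fst p" "fst q"] r(1)[of "fst p"] by (cases "fst p = fst q") (auto simp: m_def)
  qed
  have "m ` Sigma I F \<in> fine_packings maxdist \<Delta> \<delta> E"
    unfolding fine_packings_def mem_Collect_eq
  proof (intro conjI)
    show "finite (m ` Sigma I F)" using assms(1) F(1) by auto
    show "is_packing maxdist (m ` Sigma I F)"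
      unfolding is_packing_def
    proof (intro conjI ballI impI)
      fix p q assume "p \<in> m ` Sigma I F" "q \<in> m ` Sigma I F" "p \<noteq> q"
      then obtain i y j z where pq: "p = m (i, y)" "i \<in> I" "y \<in> F i" "q = m (j, z)" "j \<in> I" "z \<in> F j"
        by auto
      show "snd p < maxdist (fst p) (fst q)"
      \<comment> \<open>Over one centre the second coordinates are far enough apart, over two
        centres the first ones are; the maximum metric needs only one of them.\<close>
      proof (cases "i = j")
        case True
        with \<open>p \<noteq> q\<close> pq have "y \<noteq> z" by auto
        with True pq F(3)[of i y z] show ?thesis by (auto simp: m_def maxdist_def)
      next
        case False
        with pq sep[of i j] show ?thesis by (auto simp: m_def maxdist_def)
      qed
    qed (use r in \<open>auto simp: m_def\<close>)
    show "fst ` m ` Sigma I F \<subseteq> E"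
      using F(2) by (fastforce simp: m_def xsection_def)
  qed (use r in \<open>auto simp: m_def\<close>)
  then have le: "(\<Sum>q\<in>m ` Sigma I F. ennreal (g (snd q) * h (snd q)))
      \<le> packing_sup maxdist (\<lambda>r. g r * h r) \<Delta> \<delta> E"
    by (rule sum_le_packing_sup)
  have "(\<Sum>i\<in>I. c i * ennreal (h (r i)))
      \<le> (\<Sum>i\<in>I. of_nat (card (F i)) * ennreal (g (r i)) * ennreal (h (r i)))"
    by (intro sum_mono mult_right_mono F(4)) auto
  also have "\<dots> = (\<Sum>i\<in>I. \<Sum>y\<in>F i. ennreal (g (r i) * h (r i)))"
    using r(1) hausdorff_fun_pos[OF g] hausdorff_fun_pos[OF h]
    by (intro sum.cong refl) (simp add: ennreal_mult less_imp_le mult.assoc)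
  also have "\<dots> = (\<Sum>q\<in>m ` Sigma I F. ennreal (g (snd q) * h (snd q)))"
    unfolding sum.reindex[OF inj] using assms(1) F(1)
    by (subst sum.Sigma) (auto simp: m_def intro!: sum.cong)
  also note le
  finally show ?thesis .
qed

text \<open>The suprema are taken one index at a time, as addition commutes with nonempty suprema.
  The spare summand \<open>b\<close> carries the terms already chosen through the induction.\<close>

lemma sum_SUP_le_ennreal:
  fixes f :: "'i \<Rightarrow> 'j \<Rightarrow> ennreal"
  assumes "finite I" and "\<And>i. i \<in> I \<Longrightarrow> S i \<noteq> {}"
    and "\<And>a. (\<And>i. i \<in> I \<Longrightarrow> a i \<in> S i) \<Longrightarrow> (\<Sum>i\<in>I. f i (a i)) + b \<le> C"
  shows "(\<Sum>i\<in>I. SUP j\<in>S i. f i j) + b \<le> C"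
  using assms
proof (induction I arbitrary: b rule: finite_induct)
  case (insert k I)
  have "(\<Sum>i\<in>I. SUP j\<in>S i. f i j) + (b + f k j) \<le> C" if "j \<in> S k" for j
  proof (rule insert.IH)
    fix a assume a: "\<And>i. i \<in> I \<Longrightarrow> a i \<in> S i"
    have "(\<Sum>i\<in>insert k I. f i ((a(k := j)) i)) + b \<le> C"
      by (rule insert.prems) (use a that in auto)
    also have "(\<Sum>i\<in>insert k I. f i ((a(k := j)) i)) = f k j + (\<Sum>i\<in>I. f i (a i))"
      using insert.hyps by (auto intro!: sum.cong)
    finally show "(\<Sum>i\<in>I. f i (a i)) + (b + f k j) \<le> C" by (simp add: ac_simps)
  qed (use insert.prems in auto)
  then have "(SUP j\<in>S k. f k j + ((\<Sum>i\<in>I. SUP j\<in>S i. f i j) + b)) \<le> C"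
    by (intro SUP_least) (simp add: ac_simps)
  also have "(SUP j\<in>S k. f k j + ((\<Sum>i\<in>I. SUP j\<in>S i. f i j) + b)) =
      (SUP j\<in>S k. f k j) + ((\<Sum>i\<in>I. SUP j\<in>S i. f i j) + b)"
    using insert.prems(1) by (intro ennreal_SUP_add_left) simp
  also have "\<dots> = (\<Sum>i\<in>insert k I. SUP j\<in>S i. f i j) + b"
    using insert.hyps by (simp add: ac_simps)
  finally show ?case .
qed simp

text \<open>Finite packings of the sets \<open>K i\<close> are perturbed into \<open>A i\<close>, which the strict inequalities permit.\<close>

lemma layered_packing_sup_le:
  fixes K A :: "'i \<Rightarrow> 'a::metric_space set" and E :: "('a \<times> 'b::metric_space) set"
  assumes "finite I" and \<delta>: "\<delta> < \<eta>" "\<delta> < e"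
    and K: "\<And>i. i \<in> I \<Longrightarrow> K i \<subseteq> closure (A i)"
    and sep: "\<And>i j x y. i \<in> I \<Longrightarrow> j \<in> I \<Longrightarrow> i \<noteq> j \<Longrightarrow> x \<in> K i \<Longrightarrow> y \<in> K j \<Longrightarrow> e \<le> dist x y"
    and A: "\<And>i x r. i \<in> I \<Longrightarrow> x \<in> A i \<Longrightarrow> 0 < r \<Longrightarrow> r < \<eta> \<Longrightarrow>
              s i < capacity dist r (xsection E x) * ennreal (g r)"
    and g: "hausdorff_fun g" and h: "hausdorff_fun h"
  shows "(\<Sum>i\<in>I. s i * packing_sup dist h \<Delta> \<delta> (K i))
      \<le> packing_sup maxdist (\<lambda>r. g r * h r) \<Delta> \<delta> E" (is "_ \<le> ?C")
proof -
  have "(\<Sum>i\<in>I. SUP P\<in>fine_packings dist \<Delta> \<delta> (K i). s i * (\<Sum>p\<in>P. ennreal (h (snd p)))) + 0 \<le> ?C"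
  proof (rule sum_SUP_le_ennreal[OF \<open>finite I\<close> fine_packings_nonempty])
    fix P assume P: "\<And>i. i \<in> I \<Longrightarrow> P i \<in> fine_packings dist \<Delta> \<delta> (K i)"
    then have fin: "\<And>i. i \<in> I \<Longrightarrow> finite (P i)" by (simp add: fine_packings_def)
    define J where "J = Sigma I P"
    have finJ: "finite J" unfolding J_def using \<open>finite I\<close> fin by auto
    have PD: "0 < snd p" "snd p \<in> \<Delta>" "snd p \<le> \<delta>" "fst p \<in> K i" if "i \<in> I" "p \<in> P i" for i p
      using P[OF that(1)] that(2) by (auto simp: fine_packings_def is_packing_def)
    have inJ: "fst j \<in> I" "snd j \<in> P (fst j)" "0 < snd (snd j)" "snd (snd j) \<in> \<Delta>" "snd (snd j) \<le> \<delta>"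
      "fst (snd j) \<in> K (fst j)" if "j \<in> J" for j
      using that PD[of "fst j" "snd j"] by (auto simp: J_def)
    \<comment> \<open>The slack in the packing inequality for an ordered pair of centres.\<close>
    define \<rho> :: "('i \<times> 'a \<times> real) \<times> ('i \<times> 'a \<times> real) \<Rightarrow> real"
      where "\<rho> = (\<lambda>(j, k). dist (fst (snd j)) (fst (snd k)) - snd (snd j))"
    have pos: "0 < \<rho> (j, k)" if "j \<in> J" "k \<in> J" "j \<noteq> k" for j k
    proof (cases "fst j = fst k")
      case True
      with that P[of "fst j"] inJ[of j] inJ[of k] show ?thesis
        by (auto simp: \<rho>_def fine_packings_def is_packing_def prod_eq_iff)
    next
      \<comment> \<open>Centres in different layers are at least \<open>e\<close> apart, while every
        radius is at most \<open>\<delta> < e\<close>.\<close>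
      case False
      with that inJ[of j] inJ[of k] sep[of "fst j" "fst k" "fst (snd j)" "fst (snd k)"] \<delta>
      show ?thesis by (auto simp: \<rho>_def)
    qed
    \<comment> \<open>The extra \<open>1\<close> keeps the set nonempty when there are no two
      centres. Moving every centre by less than \<open>R / 2\<close> uses up none of the slacks
      entirely.\<close>
    define R where "R = Min (insert 1 (\<rho> ` {(j, k). j \<in> J \<and> k \<in> J \<and> j \<noteq> k}))"
    have finR: "finite (insert 1 (\<rho> ` {(j, k). j \<in> J \<and> k \<in> J \<and> j \<noteq> k}))"
      by (auto intro: finite_subset[OF _ finite_cartesian_product[OF finJ finJ]])
    have R: "0 < R" unfolding R_def using pos finR by (subst Min_gr_iff) auto
    have R_le: "R \<le> \<rho> (j, k)" if "j \<in> J" "k \<in> J" "j \<noteq> k" for j k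
      unfolding R_def by (rule Min_le[OF finR]) (use that in auto)
    have "\<exists>y\<in>A (fst j). dist y (fst (snd j)) < R / 2" if "j \<in> J" for j
    proof -
      have "fst (snd j) \<in> closure (A (fst j))" using inJ[OF that] K by blast
      with R show ?thesis unfolding closure_approachable by (meson half_gt_zero)
    qed
    then obtain x where x: "\<And>j. j \<in> J \<Longrightarrow> x j \<in> A (fst j)" "\<And>j. j \<in> J \<Longrightarrow> dist (x j) (fst (snd j)) < R / 2"
      by metis
    have "(\<Sum>j\<in>J. s (fst j) * ennreal (h (snd (snd j)))) \<le> ?C"
    proof (rule sum_le_product_packing_sup[where x=x, OF finJ])
      fix j k assume jk: "j \<in> J" "k \<in> J" "j \<noteq> k"
      have "dist (fst (snd j)) (fst (snd k)) \<le> dist (x j) (fst (snd j)) + dist (x j) (x k) + dist (x k) (fst (snd k))"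
        by metric
      with x(2)[OF jk(1)] x(2)[OF jk(2)] R_le[OF jk] show "snd (snd j) < dist (x j) (x k)"
        by (simp add: \<rho>_def)
    next
      fix j assume "j \<in> J"
      with A x(1) inJ \<delta> show "s (fst j) < capacity dist (snd (snd j)) (xsection E (x j)) * ennreal (g (snd (snd j)))"
        by (metis le_less_trans)
    qed (use inJ g h in auto)
    also have "(\<Sum>j\<in>J. s (fst j) * ennreal (h (snd (snd j)))) = (\<Sum>i\<in>I. s i * (\<Sum>p\<in>P i. ennreal (h (snd p))))"
      unfolding J_def using \<open>finite I\<close> fin by (simp add: sum.Sigma sum_distrib_left split_beta)
    finally show "(\<Sum>i\<in>I. s i * (\<Sum>p\<in>P i. ennreal (h (snd p)))) + 0 \<le> ?C" by simp
  qed
  then show ?thesis by (simp add: packing_sup_def[of dist] SUP_mult_left_ennreal)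
qed

section \<open>Convergence and subadditivity of upper integrals\<close>

text \<open>The pointwise liminf is itself a measurable majorant of \<open>f\<close>, and Fatou's
  lemma bounds its integral.\<close>

lemma upper_integral_le_liminf:
  assumes "\<And>n. \<phi> n \<in> borel_measurable M" and "\<And>n. (\<integral>\<^sup>+ x. \<phi> n x \<partial>M) \<le> c"
    and "\<And>x. f x \<le> liminf (\<lambda>n. \<phi> n x)"
  shows "upper_integral M f \<le> c"
proof -
  have "upper_integral M f \<le> (\<integral>\<^sup>+ x. liminf (\<lambda>n. \<phi> n x) \<partial>M)"
    unfolding upper_integral_def by (rule INF_lower) (use assms in auto)
  also have "\<dots> \<le> liminf (\<lambda>n. \<integral>\<^sup>+ x. \<phi> n x \<partial>M)"
    using assms(1) by (rule nn_integral_liminf)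
  also have "\<dots> \<le> liminf (\<lambda>n. c)"
    using assms(2) by (intro Liminf_mono) auto
  also have "\<dots> = c" by (simp add: Liminf_const)
  finally show ?thesis .
qed

lemma upper_integral_less_obtains:
  assumes "upper_integral M f < c"
  obtains \<phi> where "\<phi> \<in> borel_measurable M" "\<And>x. x \<in> space M \<Longrightarrow> f x \<le> \<phi> x" "(\<integral>\<^sup>+ x. \<phi> x \<partial>M) < c"
  using assms unfolding upper_integral_def INF_less_iff by auto

text \<open>Monotone convergence for upper integrals. The chosen majorants need not increase with
  \<open>n\<close>, but the functions \<open>u n\<close> do, so their supremum is a liminf and lies
  below the liminf of the majorants.\<close>

lemma upper_integral_SUP_le:
  assumes "space M = UNIV" and "\<And>x. incseq (\<lambda>n. u n x)" and "\<And>n. upper_integral M (u n) \<le> c"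
    and "\<And>x. f x \<le> (SUP n. u n x)"
  shows "upper_integral M f \<le> c"
proof (rule dense_ge)
  fix c' assume "c < c'"
  have "\<exists>\<phi>. \<phi> \<in> borel_measurable M \<and> (\<forall>x. u n x \<le> \<phi> x) \<and> (\<integral>\<^sup>+ x. \<phi> x \<partial>M) \<le> c'" for n
  proof -
    have "upper_integral M (u n) < c'" using assms(3)[of n] \<open>c < c'\<close> by (rule le_less_trans)
    then show ?thesis
      by (rule upper_integral_less_obtains) (use assms(1) in \<open>auto intro: less_imp_le\<close>)
  qed
  then obtain \<phi> where \<phi>: "\<And>n. \<phi> n \<in> borel_measurable M" "\<And>n x. u n x \<le> \<phi> n x"
      "\<And>n. (\<integral>\<^sup>+ x. \<phi> n x \<partial>M) \<le> c'"
    by metis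
  show "upper_integral M f \<le> c'"
  proof (rule upper_integral_le_liminf[OF \<phi>(1) \<phi>(3)])
    fix x
    have "f x \<le> (SUP n. u n x)" by (rule assms(4))
    also have "\<dots> = liminf (\<lambda>n. u n x)"
      by (rule lim_imp_Liminf[OF _ LIMSEQ_SUP[OF assms(2)], symmetric]) simp
    also have "\<dots> \<le> liminf (\<lambda>n. \<phi> n x)"
      using \<phi>(2) by (intro Liminf_mono) auto
    finally show "f x \<le> liminf (\<lambda>n. \<phi> n x)" .
  qed
qed

text \<open>Majorants optimal up to errors with sum \<open>e\<close> are added up; their sum
  majorizes \<open>f\<close>.\<close>

lemma upper_integral_suminf_le:
  assumes "space M = UNIV" and "\<And>x. f x \<le> (\<Sum>n. u n x)"
  shows "upper_integral M f \<le> (\<Sum>n. upper_integral M (u n))"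
proof (rule ennreal_le_epsilon)
  fix e :: real assume fin: "(\<Sum>n. upper_integral M (u n)) < top" and e: "0 < e"
  have "\<exists>\<phi>. \<phi> \<in> borel_measurable M \<and> (\<forall>x. u n x \<le> \<phi> x) \<and>
      (\<integral>\<^sup>+ x. \<phi> x \<partial>M) \<le> upper_integral M (u n) + ennreal (e * (1/2)^Suc n)" for n
  proof -
    have "upper_integral M (u n) \<le> (\<Sum>n. upper_integral M (u n))"
      using sum_le_suminf[of "\<lambda>n. upper_integral M (u n)" "{n}"] by simp
    with fin have "upper_integral M (u n) \<noteq> top" by (auto simp: top_unique)
    then have "upper_integral M (u n) + 0 < upper_integral M (u n) + ennreal (e * (1/2)^Suc n)"
      unfolding ennreal_add_left_cancel_less using e by simp
    then have "upper_integral M (u n) < upper_integral M (u n) + ennreal (e * (1/2)^Suc n)" by simp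
    then show ?thesis
      by (rule upper_integral_less_obtains) (use assms(1) in \<open>auto intro: less_imp_le\<close>)
  qed
  then obtain \<phi> where \<phi>: "\<And>n. \<phi> n \<in> borel_measurable M" "\<And>n x. u n x \<le> \<phi> n x"
      "\<And>n. (\<integral>\<^sup>+ x. \<phi> n x \<partial>M) \<le> upper_integral M (u n) + ennreal (e * (1/2)^Suc n)"
    by metis
  have "f x \<le> (\<Sum>n. \<phi> n x)" for x
    by (rule order_trans[OF assms(2)]) (intro suminf_le \<phi>(2) summableI)
  then have "upper_integral M f \<le> (\<integral>\<^sup>+ x. (\<Sum>n. \<phi> n x) \<partial>M)"
    unfolding upper_integral_def by (intro INF_lower) (use \<phi>(1) in auto)
  also have "\<dots> = (\<Sum>n. \<integral>\<^sup>+ x. \<phi> n x \<partial>M)"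
    using \<phi>(1) by (rule nn_integral_suminf)
  also have "\<dots> \<le> (\<Sum>n. upper_integral M (u n) + ennreal (e * (1/2)^Suc n))"
    by (intro suminf_le \<phi>(3) summableI)
  also have "\<dots> = (\<Sum>n. upper_integral M (u n)) + (\<Sum>n. ennreal (e * (1/2)^Suc n))"
    by (rule suminf_add[symmetric]) (rule summableI)+
  also have "(\<Sum>n. ennreal (e * (1/2)^Suc n)) = ennreal e"
    using e sums_mult[OF power_half_series, of e] by (intro suminf_ennreal_eq) auto
  finally show "upper_integral M f \<le> (\<Sum>n. upper_integral M (u n)) + ennreal e" .
qed

section \<open>Step majorants and the bound by the premeasure\<close>

text \<open>The majorant takes the value \<open>s j\<close> on \<open>D j - D (Suc j)\<close>, where \<open>D j\<close> is the closure of the \<open>j\<close>-th level set.\<close>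

lemma step_majorant:
  fixes E :: "('a::metric_space \<times> 'b::metric_space) set" and s :: "nat \<Rightarrow> ennreal"
  assumes \<nu>: "sets \<nu> = sets borel" "\<And>K. closed K \<Longrightarrow> emeasure \<nu> K \<le> P0 dist h \<Delta> K"
    and s: "incseq s" and \<eta>: "0 < \<eta>"
    and g: "hausdorff_fun g" and h: "hausdorff_fun h"
  shows "\<exists>\<phi>\<in>borel_measurable \<nu>. (\<integral>\<^sup>+ x. \<phi> x \<partial>\<nu>) \<le> P0 maxdist (\<lambda>r. g r * h r) \<Delta> E \<and>
    (\<forall>k\<le>m. \<forall>x. (\<forall>r. 0 < r \<longrightarrow> r < \<eta> \<longrightarrow> s k < capacity dist r (xsection E x) * ennreal (g r)) \<longrightarrow> s k \<le> \<phi> x)"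
proof -
  define A where "A = (\<lambda>k. {x. \<forall>r. 0 < r \<longrightarrow> r < \<eta> \<longrightarrow> s k < capacity dist r (xsection E x) * ennreal (g r)})"
  \<comment> \<open>The empty value past \<open>m\<close> makes the top layer
    \<open>D m - D (Suc m)\<close> all of \<open>D m\<close>.\<close>
  define D where "D = (\<lambda>k. if k \<le> m then closure (A k) else {})"
  have closedD: "closed (D k)" for k by (simp add: D_def)
  have decA: "A j \<subseteq> A i" if "i \<le> j" for i j
    using incseqD[OF s that] by (auto simp: A_def intro: le_less_trans)
  have decD: "D j \<subseteq> D i" if "i \<le> j" for i j
    using that closure_mono[OF decA[OF that]] by (auto simp: D_def)
  define \<phi> where "\<phi> = (\<lambda>x. \<Sum>j\<le>m. s j * indicator (D j - D (Suc j)) x)"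
  have setsD: "D j - D (Suc j) \<in> sets \<nu>" for j
    using closedD \<nu>(1) by (auto intro: borel_closed)
  have meas: "\<phi> \<in> borel_measurable \<nu>"
    unfolding \<phi>_def using setsD by measurable
  define e where "e = (\<lambda>n. inverse (real (Suc n)))"
  \<comment> \<open>The part of a layer at distance at least \<open>e n\<close> from the next
    closure, hence from all higher layers. It is closed, and closed sets are where the bound on
    \<open>\<nu>\<close> is available.\<close>
  define K where "K = (\<lambda>j n. {x \<in> D j. \<forall>y\<in>D (Suc j). e n \<le> dist x y})"
  have closedK: "closed (K j n)" for j n
  proof -
    have "K j n = D j \<inter> (\<Inter>y\<in>D (Suc j). {x. e n \<le> dist x y})" by (auto simp: K_def)
    then show ?thesis by (auto intro!: closedD closed_Int closed_INT closed_Collect_le continuous_intros)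
  qed
  have incK: "incseq (K j)" for j
  proof (rule incseq_SucI, rule subsetI)
    fix n x assume "x \<in> K j n"
    moreover have "e (Suc n) \<le> e n" by (simp add: e_def)
    ultimately show "x \<in> K j (Suc n)" by (force simp: K_def)
  qed
  have UK: "(\<Union>n. K j n) = D j - D (Suc j)" for j
  proof
    show "(\<Union>n. K j n) \<subseteq> D j - D (Suc j)"
      by (auto simp: K_def e_def dest!: bspec)
    show "D j - D (Suc j) \<subseteq> (\<Union>n. K j n)"
    proof
      fix x assume x: "x \<in> D j - D (Suc j)"
      \<comment> \<open>Closedness of the next level set gives every point of the layer a positive
        distance from it.\<close>
      obtain r where r: "0 < r" "ball x r \<subseteq> - D (Suc j)"
        using openE[OF open_Compl[OF closedD[of "Suc j"]], of x] x by blast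
      then have "r \<le> dist x y" if "y \<in> D (Suc j)" for y
        using that by (meson ComplD mem_ball not_le subsetD)
      moreover obtain n where "e n < r" unfolding e_def using reals_Archimedean[OF r(1)] by blast
      ultimately have "x \<in> K j n"
        using x unfolding K_def by (auto intro: less_imp_le less_le_trans)
      then show "x \<in> (\<Union>n. K j n)" by blast
    qed
  qed
  have K_le: "(\<Sum>j\<le>m. s j * emeasure \<nu> (K j n)) \<le> P0 maxdist (\<lambda>r. g r * h r) \<Delta> E" for n
  proof (rule le_P0_I)
    show "0 < min \<eta> (e n)" using \<eta> by (simp add: e_def)
    fix \<delta> assume \<delta>: "0 < \<delta>" "\<delta> < min \<eta> (e n)"
    have "(\<Sum>j\<le>m. s j * emeasure \<nu> (K j n)) \<le> (\<Sum>j\<le>m. s j * packing_sup dist h \<Delta> \<delta> (K j n))"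
      by (intro sum_mono mult_left_mono order_trans[OF \<nu>(2)[OF closedK] P0_le_packing_sup[OF \<delta>(1)]]) simp
    also have "\<dots> \<le> packing_sup maxdist (\<lambda>r. g r * h r) \<Delta> \<delta> E"
    proof (rule layered_packing_sup_le[where A=A and \<eta>=\<eta> and e="e n"])
      fix i j x y assume "i \<noteq> j" "x \<in> K i n" "y \<in> K j n"
      \<comment> \<open>The point in the higher layer lies in the closure just above the lower
        layer, because the sets \<open>D\<close> decrease; the lower point keeps its distance from
        that closure.\<close>
      then consider "i < j" "x \<in> K i n" "y \<in> D j" | "j < i" "y \<in> K j n" "x \<in> D i"
        by (auto simp: K_def nat_neq_iff)
      then show "e n \<le> dist x y"
      proof cases
        case 1
        with decD[of "Suc i" j] show ?thesis by (auto simp: K_def)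
      next
        case 2
        with decD[of "Suc j" i] show ?thesis by (auto simp: K_def dist_commute)
      qed
    qed (use \<delta> g h in \<open>auto simp: K_def D_def A_def\<close>)
    finally show "(\<Sum>j\<le>m. s j * emeasure \<nu> (K j n)) \<le> packing_sup maxdist (\<lambda>r. g r * h r) \<Delta> \<delta> E" .
  qed
  have "(\<integral>\<^sup>+ x. \<phi> x \<partial>\<nu>) = (\<Sum>j\<le>m. s j * emeasure \<nu> (D j - D (Suc j)))"
    unfolding \<phi>_def using setsD by (subst nn_integral_sum) (auto simp: nn_integral_cmult_indicator)
  \<comment> \<open>Continuity of \<open>\<nu>\<close> from below along the closed sets exhausting
    each layer.\<close>
  also have "\<dots> = (\<Sum>j\<le>m. SUP n. s j * emeasure \<nu> (K j n))"
    using closedK \<nu>(1) incK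
    by (intro sum.cong refl) (subst SUP_mult_left_ennreal[symmetric], subst SUP_emeasure_incseq, auto simp: UK intro: borel_closed)
  also have "\<dots> = (SUP n. \<Sum>j\<le>m. s j * emeasure \<nu> (K j n))"
  proof (rule ennreal_SUP_sum[symmetric])
    show "incseq (\<lambda>n. s j * emeasure \<nu> (K j n))" for j
      using closedK \<nu>(1) incseqD[OF incK]
      by (intro incseq_SucI mult_left_mono emeasure_mono) (auto intro: borel_closed)
  qed
  also have "\<dots> \<le> P0 maxdist (\<lambda>r. g r * h r) \<Delta> E"
    by (intro SUP_least K_le)
  finally have int: "(\<integral>\<^sup>+ x. \<phi> x \<partial>\<nu>) \<le> P0 maxdist (\<lambda>r. g r * h r) \<Delta> E" .
  have "s k \<le> \<phi> x" if "k \<le> m" "x \<in> A k" for k x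
  proof -
    \<comment> \<open>The last closure containing \<open>x\<close> may have an index larger than
      \<open>k\<close>; as \<open>s\<close> increases, this does no harm.\<close>
    define j where "j = Max {j. j \<le> m \<and> x \<in> D j}"
    have fin: "finite {j. j \<le> m \<and> x \<in> D j}" by simp
    have k: "k \<in> {j. j \<le> m \<and> x \<in> D j}" using that closure_subset[of "A k"] by (auto simp: D_def)
    have "j \<in> {j. j \<le> m \<and> x \<in> D j}"
      unfolding j_def by (rule Max_in[OF fin]) (use k in blast)
    moreover have "k \<le> j" unfolding j_def by (rule Max_ge[OF fin k])
    ultimately have j: "j \<le> m" "x \<in> D j" "k \<le> j" by simp_all
    have "x \<notin> D (Suc j)"
    proof
      assume "x \<in> D (Suc j)"
      then have "Suc j \<in> {j. j \<le> m \<and> x \<in> D j}" by (auto simp: D_def split: if_splits)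
      from Max_ge[OF fin this] show False by (simp add: j_def)
    qed
    have "s k \<le> s j" using incseqD[OF s j(3)] .
    also have "\<dots> = s j * indicator (D j - D (Suc j)) x" using j \<open>x \<notin> D (Suc j)\<close> by simp
    also have "\<dots> \<le> \<phi> x"
      unfolding \<phi>_def using j(1) by (intro member_le_sum) auto
    finally show ?thesis .
  qed
  with meas int show ?thesis by (intro bexI[of _ \<phi>]) (auto simp: A_def)
qed

text \<open>Finer grids of levels and smaller ranges of radii give step majorants whose liminf
  dominates \<open>B0\<close> of the section, while all their integrals stay below the same
  \<open>P0\<close>. Fatou's lemma then applies.\<close>

lemma upper_integral_B0_le_P0:
  fixes E :: "('a::metric_space \<times> 'b::metric_space) set"
  assumes \<nu>: "sets \<nu> = sets borel" "\<And>K. closed K \<Longrightarrow> emeasure \<nu> K \<le> P0 dist h \<Delta> K"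
    and g: "hausdorff_fun g" and h: "hausdorff_fun h"
  shows "upper_integral \<nu> (\<lambda>x. B0 dist g (xsection E x)) \<le> P0 maxdist (\<lambda>r. g r * h r) \<Delta> E"
proof -
  \<comment> \<open>Levels of mesh \<open>1 / Suc n\<close>; with \<open>k\<close> up to
    \<open>Suc n * Suc n\<close> they reach up to \<open>Suc n\<close>, so mesh and range improve
    together.\<close>
  define s :: "nat \<Rightarrow> nat \<Rightarrow> ennreal" where "s = (\<lambda>n k. ennreal (real k / real (Suc n)))"
  have "incseq (s n)" for n
    unfolding s_def by (intro incseq_SucI ennreal_leI divide_right_mono) auto
  then have "\<forall>n. \<exists>\<phi>. \<phi> \<in> borel_measurable \<nu> \<and> (\<integral>\<^sup>+ x. \<phi> x \<partial>\<nu>) \<le> P0 maxdist (\<lambda>r. g r * h r) \<Delta> E \<and>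
    (\<forall>k\<le>Suc n * Suc n. \<forall>x. (\<forall>r. 0 < r \<longrightarrow> r < inverse (real (Suc n)) \<longrightarrow>
        s n k < capacity dist r (xsection E x) * ennreal (g r)) \<longrightarrow> s n k \<le> \<phi> x)"
    by (intro allI step_majorant[OF \<nu> _ _ g h, unfolded Bex_def]) auto
  from choice[OF this] obtain \<phi> where
    "\<forall>n. \<phi> n \<in> borel_measurable \<nu> \<and> (\<integral>\<^sup>+ x. \<phi> n x \<partial>\<nu>) \<le> P0 maxdist (\<lambda>r. g r * h r) \<Delta> E \<and>
    (\<forall>k\<le>Suc n * Suc n. \<forall>x. (\<forall>r. 0 < r \<longrightarrow> r < inverse (real (Suc n)) \<longrightarrow>
        s n k < capacity dist r (xsection E x) * ennreal (g r)) \<longrightarrow> s n k \<le> \<phi> n x)" ..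
  then have \<phi>: "\<And>n. \<phi> n \<in> borel_measurable \<nu>"
    "\<And>n. (\<integral>\<^sup>+ x. \<phi> n x \<partial>\<nu>) \<le> P0 maxdist (\<lambda>r. g r * h r) \<Delta> E"
    "\<And>n k x. k \<le> Suc n * Suc n \<Longrightarrow> (\<And>r. 0 < r \<Longrightarrow> r < inverse (real (Suc n)) \<Longrightarrow>
        s n k < capacity dist r (xsection E x) * ennreal (g r)) \<Longrightarrow> s n k \<le> \<phi> n x"
    by simp_all
  show ?thesis
  proof (rule upper_integral_le_liminf[OF \<phi>(1,2)])
    fix x
    show "B0 dist g (xsection E x) \<le> liminf (\<lambda>n. \<phi> n x)"
    proof (rule dense_le)
      fix t assume "t < B0 dist g (xsection E x)"
      \<comment> \<open>The room between \<open>t\<close> and \<open>t'\<close> will contain a level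
        of every sufficiently fine grid.\<close>
      then obtain t' where t': "t < t'" "t' < B0 dist g (xsection E x)" using dense by blast
      have "t' < top" using t'(2) by (rule less_le_trans) simp
      with t' obtain a b where ab: "t = ennreal a" "0 \<le> a" "t' = ennreal b" "0 \<le> b"
        by (cases t; cases t') auto
      with t' have "a < b" by (simp add: ennreal_less_iff)
      from t'(2) have "eventually (\<lambda>r. t' < capacity dist r (xsection E x) * ennreal (g r)) (at_right 0)"
        unfolding B0_def by (rule less_LiminfD)
      then obtain \<beta> where \<beta>: "0 < \<beta>"
        "\<And>r. 0 < r \<Longrightarrow> r < \<beta> \<Longrightarrow> t' < capacity dist r (xsection E x) * ennreal (g r)"
        unfolding eventually_at_right_field by auto
      \<comment> \<open>For large \<open>n\<close> the radii considered lie below \<beta> and the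
        mesh is less than \<open>b - a\<close>; the next condition puts \<open>b\<close> within
        reach of the grid.\<close>
      have "eventually (\<lambda>n. inverse (real (Suc n)) < min \<beta> (b - a)) sequentially"
        using \<beta>(1) \<open>a < b\<close> by (intro order_tendstoD(2)[OF LIMSEQ_inverse_real_of_nat]) auto
      moreover have "eventually (\<lambda>n. b \<le> real n) sequentially"
        using filterlim_real_sequentially by (auto simp: filterlim_at_top)
      ultimately have "eventually (\<lambda>n. t \<le> \<phi> n x) sequentially"
      proof eventually_elim
        case (elim n)
        \<comment> \<open>The first level not below \<open>a\<close>; rounding up costs at most one
          mesh, so it stays below \<open>b\<close>.\<close>
        define k where "k = nat \<lceil>a * real (Suc n)\<rceil>"
        have k: "a * real (Suc n) \<le> real k" "real k \<le> a * real (Suc n) + 1"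
          using ab(2) ceiling_correct[of "a * real (Suc n)"] by (simp_all add: k_def)
        have "real k / real (Suc n) \<le> a + inverse (real (Suc n))"
          using divide_right_mono[OF k(2), of "real (Suc n)"] by (simp add: add_divide_distrib inverse_eq_divide)
        with elim have kb: "real k / real (Suc n) \<le> b" by simp
        then have "real k \<le> b * real (Suc n)" by (simp add: field_simps)
        also have "\<dots> \<le> real (Suc n) * real (Suc n)"
          using elim by (intro mult_right_mono) auto
        finally have "k \<le> Suc n * Suc n" by (simp only: of_nat_mult[symmetric] of_nat_le_iff)
        then have "s n k \<le> \<phi> n x"
        proof (rule \<phi>(3))
          fix r assume "0 < r" "r < inverse (real (Suc n))"
          with elim have "t' < capacity dist r (xsection E x) * ennreal (g r)" by (intro \<beta>(2)) auto
          moreover have "s n k \<le> t'" unfolding s_def ab using kb by (rule ennreal_leI)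
          ultimately show "s n k < capacity dist r (xsection E x) * ennreal (g r)" by simp
        qed
        moreover have "t \<le> s n k"
          unfolding s_def ab using k(1) by (intro ennreal_leI) (simp add: field_simps)
        ultimately show ?case by simp
      qed
      then show "t \<le> liminf (\<lambda>n. \<phi> n x)" by (rule Liminf_bounded)
    qed
  qed
qed

section \<open>Borel restrictions and their bounds by the premeasure\<close>

lemma sets_borel_restr: "sets (borel_restr \<mu>) = sets borel"
  using sets.sigma_sets_eq[of borel] by (simp add: borel_restr_def)

lemma space_borel_restr: "space (borel_restr \<mu>) = UNIV"
  by (simp add: borel_restr_def)

text \<open>If \<open>\<mu>\<close> is not a measure on the Borel sets, \<^const>\<open>measure_of\<close> yields the zero measure.\<close>

lemma emeasure_borel_restr_le: "emeasure (borel_restr \<mu>) K \<le> \<mu> K"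
  by (simp add: borel_restr_def emeasure_measure_of_conv)

text \<open>\<open>E\<close> followed by empty sets is a cover, and the empty sets contribute
  nothing.\<close>

lemma hat_le:
  assumes "\<tau> {} = 0"
  shows "hat \<tau> E \<le> \<tau> E"
proof -
  define A where "A = (\<lambda>n::nat. if n = 0 then E else {})"
  have "hat \<tau> E \<le> (\<Sum>n. \<tau> (A n))"
    unfolding hat_def by (rule INF_lower) (auto simp: A_def)
  also have "\<dots> = (\<Sum>n\<in>{0}. \<tau> (A n))"
    by (rule suminf_finite) (auto simp: A_def assms)
  finally show ?thesis by (simp add: A_def)
qed

lemma is_scale_greaterThan_0: "is_scale {0<..}"
  by (simp add: is_scale_def closure_greaterThan)

lemma Pbar_le_P0: "Pbar d g E \<le> P0 d g {0<..} E"
  using hat_le[of "Pbar0 d g" E] by (simp add: Pbar_def Pbar0_def P0_empty)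

lemma Plow0_le_P0: "is_scale \<Delta> \<Longrightarrow> Plow0 d g E \<le> P0 d g \<Delta> E"
  unfolding Plow0_def by (rule INF_lower) simp

lemma Plow_le_P0:
  assumes "is_scale \<Delta>"
  shows "Plow d g E \<le> P0 d g \<Delta> E"
proof -
  have "Plow0 d g {} = 0"
    using Plow0_le_P0[OF is_scale_greaterThan_0, of d g "{}"] by (simp add: P0_empty)
  then have "Plow d g E \<le> Plow0 d g E"
    unfolding Plow_def by (rule hat_le)
  also have "\<dots> \<le> P0 d g \<Delta> E" using assms by (rule Plow0_le_P0)
  finally show ?thesis .
qed

section \<open>Sections of exhaustions and covers\<close>

lemma capacity_mono: "A \<subseteq> B \<Longrightarrow> capacity d \<delta> A \<le> capacity d \<delta> B"
  unfolding capacity_def by (rule SUP_subset_mono) auto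

lemma B0_mono: "A \<subseteq> B \<Longrightarrow> B0 d g A \<le> B0 d g B"
  unfolding B0_def by (intro Liminf_mono always_eventually allI mult_right_mono capacity_mono) auto

lemma xsection_mono: "A \<subseteq> B \<Longrightarrow> xsection A x \<subseteq> xsection B x"
  by (auto simp: xsection_def)

text \<open>Taking sections preserves increasing unions, so the sections of \<open>F n\<close>
  compete in the infimum defining \<open>arrow\<close>.\<close>

lemma Bvec_xsection_le:
  assumes "incseq F" and "(\<Union>n. F n) = E"
  shows "Bvec d g (xsection E x) \<le> (SUP n. B0 d g (xsection (F n) x))"
  unfolding Bvec_def arrow_def
  by (rule INF_lower)
    (use assms in \<open>auto simp: xsection_def incseq_def\<close>)

lemma Blow_xsection_le:
  assumes "E \<subseteq> (\<Union>n. F n)"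
  shows "Blow d g (xsection E x) \<le> (\<Sum>n. B0 d g (xsection (F n) x))"
  unfolding Blow_def hat_def
  by (rule INF_lower) (use assms in \<open>auto simp: xsection_def\<close>)

text \<open>Carries a bound common to all members of an exhaustion over to the whole set, by
  monotone convergence of upper integrals.\<close>

lemma upper_integral_Bvec_le:
  assumes "space \<nu> = UNIV" and F: "incseq F" "(\<Union>n. F n) = E"
    and "\<And>n. upper_integral \<nu> (\<lambda>x. B0 d g (xsection (F n) x)) \<le> c"
  shows "upper_integral \<nu> (\<lambda>x. Bvec d g (xsection E x)) \<le> c"
  using assms(1) _ assms(4) Bvec_xsection_le[OF F]
  by (rule upper_integral_SUP_le)
    (use F in \<open>auto simp: incseq_def intro!: B0_mono xsection_mono\<close>)

section \<open>The four product inequalities\<close>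

context
  fixes g h :: "real \<Rightarrow> real"
  assumes g: "hausdorff_fun g" and h: "hausdorff_fun h"
begin

lemma upper_integral_B0_le_Pbar0:
  "upper_integral (borel_restr (Pbar dist h)) (\<lambda>x. B0 dist g (xsection E x))
    \<le> P0 maxdist (\<lambda>r. g r * h r) {0<..} E"
  by (rule upper_integral_B0_le_P0[OF sets_borel_restr _ g h])
    (rule order_trans[OF emeasure_borel_restr_le Pbar_le_P0])

text \<open>On closed sets the integrating measure lies below \<open>P0\<close> for every scale at
  once, so the estimate survives the infimum over scales.\<close>

lemma upper_integral_B0_le_Plow0:
  "upper_integral (borel_restr (Plow dist h)) (\<lambda>x. B0 dist g (xsection E x))
    \<le> Plow0 maxdist (\<lambda>r. g r * h r) E"
  unfolding Plow0_def
proof (rule INF_greatest)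
  fix \<Delta> assume "\<Delta> \<in> {\<Delta>. is_scale \<Delta>}"
  then show "upper_integral (borel_restr (Plow dist h)) (\<lambda>x. B0 dist g (xsection E x))
    \<le> P0 maxdist (\<lambda>r. g r * h r) \<Delta> E"
    by (intro upper_integral_B0_le_P0[OF sets_borel_restr _ g h]
        order_trans[OF emeasure_borel_restr_le Plow_le_P0]) simp
qed

lemma upper_integral_Bvec_le_Pbar:
  "upper_integral (borel_restr (Pbar dist h)) (\<lambda>x. Bvec dist g (xsection E x))
    \<le> Pbar maxdist (\<lambda>r. g r * h r) E"
  unfolding Pbar_def[of maxdist] hat_def
proof (rule INF_greatest)
  fix A :: "nat \<Rightarrow> _" assume A: "A \<in> {A. E \<subseteq> (\<Union>n. A n)}"
  \<comment> \<open>The cover becomes an increasing exhaustion; intersecting with \<open>E\<close>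
    makes the union exactly \<open>E\<close>, as \<open>arrow\<close> demands.\<close>
  define F where "F = (\<lambda>n. E \<inter> (\<Union>i<n. A i))"
  show "upper_integral (borel_restr (Pbar dist h)) (\<lambda>x. Bvec dist g (xsection E x))
      \<le> (\<Sum>n. Pbar0 maxdist (\<lambda>r. g r * h r) (A n))"
  proof (rule upper_integral_Bvec_le[OF space_borel_restr, of F])
    show "incseq F" unfolding F_def incseq_def by (intro allI impI Int_mono UN_mono) auto
    show "(\<Union>n. F n) = E"
    proof (intro equalityI subsetI)
      fix p assume "p \<in> E"
      with A obtain i where "p \<in> A i" by blast
      with \<open>p \<in> E\<close> have "p \<in> F (Suc i)" by (auto simp: F_def)
      then show "p \<in> (\<Union>n. F n)" by blast
    qed (auto simp: F_def)
    fix n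
    have "upper_integral (borel_restr (Pbar dist h)) (\<lambda>x. B0 dist g (xsection (F n) x))
        \<le> P0 maxdist (\<lambda>r. g r * h r) {0<..} (F n)"
      by (rule upper_integral_B0_le_Pbar0)
    also have "\<dots> \<le> P0 maxdist (\<lambda>r. g r * h r) {0<..} (\<Union>i<n. A i)"
      by (rule P0_mono_set) (simp add: F_def)
    also have "\<dots> \<le> (\<Sum>i<n. P0 maxdist (\<lambda>r. g r * h r) {0<..} (A i))"
      by (rule P0_UN_le)
    also have "\<dots> \<le> (\<Sum>i. P0 maxdist (\<lambda>r. g r * h r) {0<..} (A i))"
      by (intro sum_le_suminf summableI) auto
    finally show "upper_integral (borel_restr (Pbar dist h)) (\<lambda>x. B0 dist g (xsection (F n) x))
        \<le> (\<Sum>n. Pbar0 maxdist (\<lambda>r. g r * h r) (A n))"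
      by (simp add: Pbar0_def)
  qed
qed

text \<open>Covers of \<open>E\<close> induce covers of the sections, so countable subadditivity of
  the upper integral takes the place of monotone convergence.\<close>

lemma upper_integral_Blow_le_Plow:
  "upper_integral (borel_restr (Plow dist h)) (\<lambda>x. Blow dist g (xsection E x))
    \<le> Plow maxdist (\<lambda>r. g r * h r) E"
  unfolding Plow_def[of maxdist] hat_def
proof (rule INF_greatest)
  fix A :: "nat \<Rightarrow> _" assume "A \<in> {A. E \<subseteq> (\<Union>n. A n)}"
  then have "upper_integral (borel_restr (Plow dist h)) (\<lambda>x. Blow dist g (xsection E x))
      \<le> (\<Sum>n. upper_integral (borel_restr (Plow dist h)) (\<lambda>x. B0 dist g (xsection (A n) x)))"
    by (intro upper_integral_suminf_le space_borel_restr Blow_xsection_le) simp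
  also have "\<dots> \<le> (\<Sum>n. Plow0 maxdist (\<lambda>r. g r * h r) (A n))"
    by (intro suminf_le upper_integral_B0_le_Plow0 summableI)
  finally show "upper_integral (borel_restr (Plow dist h)) (\<lambda>x. Blow dist g (xsection E x))
      \<le> (\<Sum>n. Plow0 maxdist (\<lambda>r. g r * h r) (A n))" .
qed

lemma upper_integral_Bvec_le_Pvec:
  "upper_integral (borel_restr (Plow dist h)) (\<lambda>x. Bvec dist g (xsection E x))
    \<le> Pvec maxdist (\<lambda>r. g r * h r) E"
  unfolding Pvec_def arrow_def
proof (rule INF_greatest)
  fix A :: "nat \<Rightarrow> _" assume A: "A \<in> {A. incseq A \<and> (\<Union>n. A n) = E}"
  show "upper_integral (borel_restr (Plow dist h)) (\<lambda>x. Bvec dist g (xsection E x))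
      \<le> (SUP n. Plow0 maxdist (\<lambda>r. g r * h r) (A n))"
  proof (rule upper_integral_Bvec_le[OF space_borel_restr, of A])
    fix n
    show "upper_integral (borel_restr (Plow dist h)) (\<lambda>x. B0 dist g (xsection (A n) x))
        \<le> (SUP n. Plow0 maxdist (\<lambda>r. g r * h r) (A n))"
      by (rule order_trans[OF upper_integral_B0_le_Plow0]) (rule SUP_upper, simp)
  qed (use A in auto)
qed

text \<open>The case of a single layer, where the separation condition is void. It compares
  premeasures directly, without an integral.\<close>

lemma mult_Plow0_le_Plow0:
  fixes A :: "'a::metric_space set" and E :: "('a \<times> 'b::metric_space) set"
  assumes "0 < \<eta>" and "\<And>x r. x \<in> A \<Longrightarrow> 0 < r \<Longrightarrow> r < \<eta> \<Longrightarrow>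
      s < capacity dist r (xsection E x) * ennreal (g r)"
  shows "s * Plow0 dist h A \<le> Plow0 maxdist (\<lambda>r. g r * h r) E"
  unfolding Plow0_def[of maxdist]
proof (rule INF_greatest)
  fix \<Delta> assume "\<Delta> \<in> {\<Delta>. is_scale \<Delta>}"
  then have "s * Plow0 dist h A \<le> s * P0 dist h \<Delta> A"
    by (intro mult_left_mono Plow0_le_P0) auto
  also have "\<dots> \<le> P0 maxdist (\<lambda>r. g r * h r) \<Delta> E"
  proof (rule le_P0_I[OF assms(1)])
    fix \<delta> assume \<delta>: "0 < \<delta>" "\<delta> < \<eta>"
    have "s * P0 dist h \<Delta> A \<le> s * packing_sup dist h \<Delta> \<delta> A"
      using \<delta> by (intro mult_left_mono P0_le_packing_sup) auto
    also have "\<dots> \<le> packing_sup maxdist (\<lambda>r. g r * h r) \<Delta> \<delta> E"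
      using layered_packing_sup_le[of "{()}" \<delta> \<eta> \<eta> "\<lambda>_. A" "\<lambda>_. A" "\<lambda>_. s" E g h \<Delta>]
        \<delta> assms g h closure_subset by auto
    finally show "s * P0 dist h \<Delta> A \<le> packing_sup maxdist (\<lambda>r. g r * h r) \<Delta> \<delta> E" .
  qed
  finally show "s * Plow0 dist h A \<le> P0 maxdist (\<lambda>r. g r * h r) \<Delta> E" .
qed

text \<open>For \<open>s\<close> below the infimum, an exhaustion of \<open>E\<close> induces one of
  the first factor: the points whose section capacities exceed level \<open>s\<close> uniformly for
  small radii. The single-layer estimate applies to each member.\<close>

lemma INF_Bvec_mult_Pvec_le_Pvec:
  fixes E :: "('a::metric_space \<times> 'b::metric_space) set"
  shows "(INF x. Bvec dist g (xsection E x)) * Pvec dist h (UNIV :: 'a set)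
    \<le> Pvec maxdist (\<lambda>r. g r * h r) E"
  unfolding Pvec_def[of maxdist] arrow_def
proof (rule INF_greatest)
  fix F :: "nat \<Rightarrow> _" assume "F \<in> {F. incseq F \<and> (\<Union>n. F n) = E}"
  then have F: "incseq F" "(\<Union>n. F n) = E" by auto
  have "s * Pvec dist h (UNIV :: 'a set) \<le> (SUP n. Plow0 maxdist (\<lambda>r. g r * h r) (F n))"
    if s: "s < (INF x. Bvec dist g (xsection E x))" for s
  proof -
    \<comment> \<open>One index controls both the section and the range of radii. As it grows, the
      sections grow and fewer radii are tested, so \<open>A\<close> increases.\<close>
    define A where "A = (\<lambda>n. {x::'a. \<forall>r. 0 < r \<longrightarrow> r < inverse (real (Suc n)) \<longrightarrow>
        s < capacity dist r (xsection (F n) x) * ennreal (g r)})"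
    have "incseq A"
    proof (rule incseq_SucI, rule subsetI)
      fix n x assume x: "x \<in> A n"
      have le: "inverse (real (Suc (Suc n))) \<le> inverse (real (Suc n))" by simp
      have cap: "capacity dist r (xsection (F n) x) * ennreal (g r)
          \<le> capacity dist r (xsection (F (Suc n)) x) * ennreal (g r)" for r
        using incseq_SucD[OF F(1)] by (intro mult_right_mono capacity_mono xsection_mono) auto
      show "x \<in> A (Suc n)"
        unfolding A_def mem_Collect_eq
      proof (intro allI impI)
        fix r assume r: "0 < r" "r < inverse (real (Suc (Suc n)))"
        from r(2) le have "r < inverse (real (Suc n))" by (rule less_le_trans)
        with x r(1) have "s < capacity dist r (xsection (F n) x) * ennreal (g r)" by (simp add: A_def)
        also note cap
        finally show "s < capacity dist r (xsection (F (Suc n)) x) * ennreal (g r)" .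
      qed
    qed
    moreover have "(\<Union>n. A n) = UNIV"
    proof -
      have "x \<in> (\<Union>n. A n)" for x
      proof -
        have "s < Bvec dist g (xsection E x)" using s by (rule less_INF_D) simp
        also have "\<dots> \<le> (SUP n. B0 dist g (xsection (F n) x))" by (rule Bvec_xsection_le[OF F])
        finally obtain n where n: "s < B0 dist g (xsection (F n) x)" by (auto simp: less_SUP_iff)
        then have "eventually (\<lambda>r. s < capacity dist r (xsection (F n) x) * ennreal (g r)) (at_right 0)"
          unfolding B0_def by (rule less_LiminfD)
        then obtain \<beta> where \<beta>: "0 < \<beta>"
          "\<And>r. 0 < r \<Longrightarrow> r < \<beta> \<Longrightarrow> s < capacity dist r (xsection (F n) x) * ennreal (g r)"
          unfolding eventually_at_right_field by auto
        obtain k where k: "inverse (real (Suc k)) < \<beta>" using reals_Archimedean[OF \<beta>(1)] by blast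
        \<comment> \<open>\<open>n\<close> makes the section large enough and \<open>k\<close> the
          radii small enough; the larger index serves both.\<close>
        have "x \<in> A (max n k)"
          unfolding A_def mem_Collect_eq
        proof (intro allI impI)
          fix r assume r: "0 < r" "r < inverse (real (Suc (max n k)))"
          have "inverse (real (Suc (max n k))) \<le> inverse (real (Suc k))" by (intro le_imp_inverse_le) auto
          with r k have "r < \<beta>" by linarith
          with r have "s < capacity dist r (xsection (F n) x) * ennreal (g r)" by (intro \<beta>(2))
          also have "\<dots> \<le> capacity dist r (xsection (F (max n k)) x) * ennreal (g r)"
            using incseqD[OF F(1), of n "max n k"] by (intro mult_right_mono capacity_mono xsection_mono) auto
          finally show "s < capacity dist r (xsection (F (max n k)) x) * ennreal (g r)" .
        qed
        then show ?thesis by blast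
      qed
      then show ?thesis by blast
    qed
    ultimately have "Pvec dist h (UNIV :: 'a set) \<le> (SUP n. Plow0 dist h (A n))"
      unfolding Pvec_def arrow_def by (intro INF_lower) simp
    then have "s * Pvec dist h (UNIV :: 'a set) \<le> s * (SUP n. Plow0 dist h (A n))"
      by (rule mult_left_mono) simp
    also have "\<dots> = (SUP n. s * Plow0 dist h (A n))" by (rule SUP_mult_left_ennreal)
    also have "\<dots> \<le> (SUP n. Plow0 maxdist (\<lambda>r. g r * h r) (F n))"
    proof (rule SUP_mono)
      fix n
      have "s * Plow0 dist h (A n) \<le> Plow0 maxdist (\<lambda>r. g r * h r) (F n)"
        by (rule mult_Plow0_le_Plow0[of "inverse (real (Suc n))"]) (auto simp: A_def)
      then show "\<exists>m\<in>UNIV. s * Plow0 dist h (A n) \<le> Plow0 maxdist (\<lambda>r. g r * h r) (F m)" by blast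
    qed
    finally show ?thesis .
  qed
  \<comment> \<open>Letting \<open>s\<close> increase to the infimum recovers the full product,
    since multiplication commutes with suprema in \<open>ennreal\<close>.\<close>
  then have "(SUP s\<in>{..<INF x. Bvec dist g (xsection E x)}. s * Pvec dist h (UNIV :: 'a set))
      \<le> (SUP n. Plow0 maxdist (\<lambda>r. g r * h r) (F n))"
    by (intro SUP_least) simp
  also have "(SUP s\<in>{..<INF x. Bvec dist g (xsection E x)}. s * Pvec dist h (UNIV :: 'a set)) =
      (INF x. Bvec dist g (xsection E x)) * Pvec dist h (UNIV :: 'a set)"
    by (simp add: SUP_mult_right_ennreal[symmetric])
  finally show "(INF x. Bvec dist g (xsection E x)) * Pvec dist h (UNIV :: 'a set)
      \<le> (SUP n. Plow0 maxdist (\<lambda>r. g r * h r) (F n))" .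
qed

end

theorem theorem3p5:
  fixes E :: "('a::metric_space \<times> 'b::metric_space) set" and g h :: "real \<Rightarrow> real"
  assumes "hausdorff_fun g" and "hausdorff_fun h"
  shows "Pbar maxdist (\<lambda>r. g r * h r) E \<ge>
           upper_integral (borel_restr (Pbar dist h)) (\<lambda>x. Bvec dist g (xsection E x)) \<and>
         Plow maxdist (\<lambda>r. g r * h r) E \<ge>
           upper_integral (borel_restr (Plow dist h)) (\<lambda>x. Blow dist g (xsection E x)) \<and>
         Pvec maxdist (\<lambda>r. g r * h r) E \<ge>
           upper_integral (borel_restr (Plow dist h)) (\<lambda>x. Bvec dist g (xsection E x)) \<and>
         Pvec maxdist (\<lambda>r. g r * h r) E \<ge>
           (INF x. Bvec dist g (xsection E x)) * Pvec dist h (UNIV :: 'a set)"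
  by (intro conjI upper_integral_Bvec_le_Pbar[OF assms] upper_integral_Blow_le_Plow[OF assms]
      upper_integral_Bvec_le_Pvec[OF assms] INF_Bvec_mult_Pvec_le_Pvec[OF assms])

end
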